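(* Let $C$ be a graph of colors with no loops, meaning no edge $k\in E(C)$ with $k=\bar k$, and fix data $(\Delta_i)_{i\in V(C)}$ for symmetry-restricted graphs over $C$ (finite permutation groups whose orbits are indexed by the edge-colors departing $i$). Let $T$ be the symmetry-restricted tree for these data (it is unique up to isomorphism), and let $H\subset\mathrm{Aut}^s(T)$ be a subgroup with $T/H=C$ (i.e. the coloring $T\to C$ induces an isomorphism $T/H\to C$). Then for any subgroup $\Gamma\subset\mathrm{Aut}^s(T)$ which acts freely on $T$, there exists $g\in\mathrm{Aut}^s(T)$ with $g\Gamma g^{-1}\subset H$.
   Context: All graphs are connected. Combinatorially, a graph $G$ consists of a vertex set $V(G)$, a directed edge set $E(G)$, an involution $e\mapsto\bar e$ on $E(G)$, and maps $\partial_0,\partial_1\colon E(G)\to V(G)$ (tail and head) with $\partial_0\bar e=\partial_1 e$. In an ordinary graph $e\ne\bar e$; a graph of colors may in general also have edges with $k=\bar k$. A graph-homomorphism commutes with $\partial_0,\partial_1$ and the involution. A $C$-colored graph is a graph with a graph-homomorphism to the graph of colors $C$; homomorphisms of $C$-colored graphs preserve colors. An $i$-vertex is a vertex of color $i\in V(C)$; a $k$-edge is a directed edge of color $k\in E(C)$. For a vertex $v$, $\mathrm{star}(v)$ denotes the set of directed edges departing $v$ (edges with tail $v$). Data for symmetry-restricted graphs: a graph of colors $C$ and, for each $i\in V(C)$, a finite permutation group $\Delta_i$ (a finite group acting faithfully on a finite set) together with an indexing of the orbits of $\Delta_i$ by the edge-colors $k\in E(C)$ with $\partial_0 k=i$ (one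 orbit for each such $k$). A symmetry-restricted graph for these data is a $C$-colored graph $G$ together with, for each $i$-vertex $v$ of $G$ (for every $i$), a representation of $\Delta_i$ as a color-preserving permutation group on $\mathrm{star}(v)$; that is, an action of $\Delta_i$ on $\mathrm{star}(v)$ that is isomorphic, as a $\Delta_i$-set, to the given permutation representation of $\Delta_i$, with the orbit indexed by $k$ corresponding to the set of $k$-edges in $\mathrm{star}(v)$. The symmetry-restricted tree for the data is a symmetry-restricted graph for the data that is a tree. If $\Delta$ is a group, a map $\phi\colon X\to Y$ of $\Delta$-sets is weakly equivariant if there is $\gamma\in\Delta$ such that $\phi(\delta x)=\gamma\delta\gamma^{-1}\phi(x)$ for all $x\in X$, $\delta\in\Delta$. A morphism $\phi\colon G\to G'$ of symmetry-restricted graphs is a colored graph homomorphism which restricts to a weakly equivariant bijection $\mathrm{star}(v)\to\mathrm{star}(\phi(v))$ for each vertex $v$ of $G$. A bijective morphism $G\to G$ is an automorphism, and $\mathrm{Aut}^s(T)$ denotes the group of symmetry-restricted automorphisms of $T$. A group acts freely on $T$ if no non-identity element fixes a point of $T$ (viewed as a $1$-complex). *)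

theory Defs
  imports
    Complex_Main
    "HOL-Algebra.Group_Action"
    "Graph_Theory.Arc_Walk"
    "Graph_Theory.Digraph_Component"
begin

section \<open>Graphs with an involution\<close>

record ('v, 'e) igraph = "('v, 'e) pre_digraph" +
  ebar :: "'e \<Rightarrow> 'e"

(* The notions of Graph_Theory are typed for pre_digraph itself, not for its extensions. *)
abbreviation digr :: "('v, 'e, 'z) igraph_scheme \<Rightarrow> ('v, 'e) pre_digraph" where
  "digr G \<equiv> pre_digraph.truncate G"

(* Graphs are connected (and, by the library definition of connectedness, nonempty).
   Edges equal to their own inverse are allowed here. *)
definition is_graph :: "('v, 'e, 'z) igraph_scheme \<Rightarrow> bool" where
  "is_graph G \<longleftrightarrow>
     wf_digraph (digr G) \<and>
     (\<forall>e\<in>arcs G. ebar G e \<in> arcs G \<and> ebar G (ebar G e) = e \<and> tail G (ebar G e) = head G e) \<and>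
     Digraph_Component.connected (digr G)"

(* A loop is an edge equal to its own inverse.  An edge e with tail e = head e and
   ebar e \<noteq> e is not a loop in this sense.  A graph in the ordinary sense is one
   without loops. *)
definition no_loops :: "('v, 'e, 'z) igraph_scheme \<Rightarrow> bool" where
  "no_loops G \<longleftrightarrow> (\<forall>e\<in>arcs G. ebar G e \<noteq> e)"

definition star :: "('v, 'e, 'z) igraph_scheme \<Rightarrow> 'v \<Rightarrow> 'e set" where
  "star G v = {e \<in> arcs G. tail G e = v}"

(* The tree predicate of Graph_Theory is not used: for it the walk e, ebar e is a cycle,
   hence no graph with an edge and its inverse is a tree. *)
definition is_tree :: "('v, 'e, 'z) igraph_scheme \<Rightarrow> bool" where
  "is_tree G \<longleftrightarrow>
     is_graph G \<and> no_loops G \<and>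
     (\<forall>u p. pre_digraph.awalk (digr G) u p u \<and> successively (\<lambda>e f. f \<noteq> ebar G e) p \<longrightarrow> p = [])"

definition graph_hom ::
  "('v, 'e, 'z) igraph_scheme \<Rightarrow> ('w, 'f, 'y) igraph_scheme \<Rightarrow> ('v \<Rightarrow> 'w) \<Rightarrow> ('e \<Rightarrow> 'f) \<Rightarrow> bool" where
  "graph_hom G G' fV fE \<longleftrightarrow>
     fV \<in> verts G \<rightarrow> verts G' \<and> fE \<in> arcs G \<rightarrow> arcs G' \<and>
     (\<forall>e\<in>arcs G. tail G' (fE e) = fV (tail G e) \<and> head G' (fE e) = fV (head G e) \<and>
                 ebar G' (fE e) = fE (ebar G e))"

definition graph_iso ::
  "('v, 'e, 'z) igraph_scheme \<Rightarrow> ('w, 'f, 'y) igraph_scheme \<Rightarrow> ('v \<Rightarrow> 'w) \<Rightarrow> ('e \<Rightarrow> 'f) \<Rightarrow> bool" where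
  "graph_iso G G' fV fE \<longleftrightarrow>
     graph_hom G G' fV fE \<and> bij_betw fV (verts G) (verts G') \<and> bij_betw fE (arcs G) (arcs G')"

section \<open>Symmetry-restricted graphs\<close>

(* grp i acts on pts i through perm i; orb k is the orbit indexed by the edge-color k. *)
record ('i, 'k, 'd, 'x) sr_data =
  grp :: "'i \<Rightarrow> 'd monoid"
  pts :: "'i \<Rightarrow> 'x set"
  perm :: "'i \<Rightarrow> 'd \<Rightarrow> 'x \<Rightarrow> 'x"
  orb :: "'k \<Rightarrow> 'x set"

definition is_sr_data :: "('i, 'k) igraph \<Rightarrow> ('i, 'k, 'd, 'x) sr_data \<Rightarrow> bool" where
  "is_sr_data C D \<longleftrightarrow>
     (\<forall>i\<in>verts C.
        finite (carrier (grp D i)) \<and> finite (pts D i) \<and>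
        faithful_action (grp D i) (pts D i) (perm D i) \<and>
        bij_betw (orb D) (star C i) (orbits (grp D i) (pts D i) (perm D i)))"

(* vcol and ecol are the coloring; act v is the action of grp (vcol v) on star v. *)
record ('v, 'e, 'i, 'k, 'd) sr_graph = "('v, 'e) igraph" +
  vcol :: "'v \<Rightarrow> 'i"
  ecol :: "'e \<Rightarrow> 'k"
  act :: "'v \<Rightarrow> 'd \<Rightarrow> 'e \<Rightarrow> 'e"

definition is_sr_graph ::
  "('i, 'k) igraph \<Rightarrow> ('i, 'k, 'd, 'x) sr_data \<Rightarrow> ('v, 'e, 'i, 'k, 'd) sr_graph \<Rightarrow> bool" where
  "is_sr_graph C D G \<longleftrightarrow>
     is_graph G \<and> no_loops G \<and> graph_hom G C (vcol G) (ecol G) \<and>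
     (\<forall>v\<in>verts G.
        group_action (grp D (vcol G v)) (star G v) (act G v) \<and>
        (\<exists>f. bij_betw f (pts D (vcol G v)) (star G v) \<and>
             (\<forall>\<delta>\<in>carrier (grp D (vcol G v)). \<forall>x\<in>pts D (vcol G v).
                f (perm D (vcol G v) \<delta> x) = act G v \<delta> (f x)) \<and>
             (\<forall>k\<in>star C (vcol G v). f ` orb D k = {e \<in> star G v. ecol G e = k})))"

definition weakly_equivariant ::
  "('d, 'm) monoid_scheme \<Rightarrow> 'a set \<Rightarrow> ('d \<Rightarrow> 'a \<Rightarrow> 'a) \<Rightarrow> ('d \<Rightarrow> 'b \<Rightarrow> 'b) \<Rightarrow> ('a \<Rightarrow> 'b) \<Rightarrow> bool" where
  "weakly_equivariant \<Delta> X \<alpha> \<beta> \<phi> \<longleftrightarrow>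
     (\<exists>\<gamma>\<in>carrier \<Delta>. \<forall>x\<in>X. \<forall>\<delta>\<in>carrier \<Delta>.
        \<phi> (\<alpha> \<delta> x) = \<beta> (\<gamma> \<otimes>\<^bsub>\<Delta>\<^esub> \<delta> \<otimes>\<^bsub>\<Delta>\<^esub> inv\<^bsub>\<Delta>\<^esub> \<gamma>) (\<phi> x))"

definition sr_morphism ::
  "('i, 'k, 'd, 'x) sr_data \<Rightarrow> ('v, 'e, 'i, 'k, 'd) sr_graph \<Rightarrow> ('w, 'f, 'i, 'k, 'd) sr_graph \<Rightarrow>
   ('v \<Rightarrow> 'w) \<Rightarrow> ('e \<Rightarrow> 'f) \<Rightarrow> bool" where
  "sr_morphism D G G' fV fE \<longleftrightarrow>
     graph_hom G G' fV fE \<and>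
     (\<forall>v\<in>verts G. vcol G' (fV v) = vcol G v) \<and> (\<forall>e\<in>arcs G. ecol G' (fE e) = ecol G e) \<and>
     (\<forall>v\<in>verts G. bij_betw fE (star G v) (star G' (fV v)) \<and>
        weakly_equivariant (grp D (vcol G v)) (star G v) (act G v) (act G' (fV v)) fE)"

(* Automorphisms are pairs (vertex map, edge map); as in BijGroup, both maps are
   extensional, so that distinct pairs are distinct automorphisms. *)
definition sr_Aut ::
  "('i, 'k, 'd, 'x) sr_data \<Rightarrow> ('v, 'e, 'i, 'k, 'd) sr_graph \<Rightarrow> (('v \<Rightarrow> 'v) \<times> ('e \<Rightarrow> 'e)) monoid" where
  "sr_Aut D G =
     \<lparr>carrier = {g. fst g \<in> Bij (verts G) \<and> snd g \<in> Bij (arcs G) \<and>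
                    sr_morphism D G G (fst g) (snd g)},
      monoid.mult = (\<lambda>g h. (compose (verts G) (fst g) (fst h), compose (arcs G) (snd g) (snd h))),
      one = (\<lambda>v\<in>verts G. v, \<lambda>e\<in>arcs G. e)\<rparr>"

subsection \<open>Automorphisms form a group\<close>

lemma weakly_equivariant_id:
  assumes "group \<Delta>" shows "weakly_equivariant \<Delta> X \<alpha> \<alpha> (\<lambda>x. x)"
proof -
  interpret group \<Delta> by fact
  show ?thesis unfolding weakly_equivariant_def by (rule bexI[of _ "\<one>\<^bsub>\<Delta>\<^esub>"]) auto
qed

lemma weakly_equivariant_comp:
  assumes "group \<Delta>" "weakly_equivariant \<Delta> X \<alpha> \<beta> \<phi>" "weakly_equivariant \<Delta> Y \<beta> \<kappa> \<psi>" "\<phi> ` X \<subseteq> Y"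
  shows "weakly_equivariant \<Delta> X \<alpha> \<kappa> (\<lambda>x. \<psi> (\<phi> x))"
proof -
  interpret group \<Delta> by fact
  obtain g where g: "g \<in> carrier \<Delta>" "\<And>x d. x\<in>X \<Longrightarrow> d \<in> carrier \<Delta> \<Longrightarrow> \<phi> (\<alpha> d x) = \<beta> (g \<otimes>\<^bsub>\<Delta>\<^esub> d \<otimes>\<^bsub>\<Delta>\<^esub> inv\<^bsub>\<Delta>\<^esub> g) (\<phi> x)"
    using assms(2) unfolding weakly_equivariant_def by blast
  obtain h where h: "h \<in> carrier \<Delta>" "\<And>x d. x\<in>Y \<Longrightarrow> d \<in> carrier \<Delta> \<Longrightarrow> \<psi> (\<beta> d x) = \<kappa> (h \<otimes>\<^bsub>\<Delta>\<^esub> d \<otimes>\<^bsub>\<Delta>\<^esub> inv\<^bsub>\<Delta>\<^esub> h) (\<psi> x)"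
    using assms(3) unfolding weakly_equivariant_def by blast
  show ?thesis unfolding weakly_equivariant_def
    apply (rule bexI[of _ "h \<otimes>\<^bsub>\<Delta>\<^esub> g"])
    using g h assms(4) by (auto simp: m_assoc inv_mult_group image_subset_iff)
qed

lemma weakly_equivariant_inv:
  assumes "group \<Delta>" "group_action \<Delta> X \<alpha>" "group_action \<Delta> Y \<beta>"
    "weakly_equivariant \<Delta> X \<alpha> \<beta> \<phi>" "bij_betw \<phi> X Y" "\<And>y. y \<in> Y \<Longrightarrow> \<psi> y = inv_into X \<phi> y"
  shows "weakly_equivariant \<Delta> Y \<beta> \<alpha> \<psi>"
proof -
  interpret group \<Delta> by fact
  interpret A: group_action \<Delta> X \<alpha> by fact
  interpret B: group_action \<Delta> Y \<beta> by fact
  obtain g where g: "g \<in> carrier \<Delta>" "\<And>x d. x\<in>X \<Longrightarrow> d \<in> carrier \<Delta> \<Longrightarrow> \<phi> (\<alpha> d x) = \<beta> (g \<otimes>\<^bsub>\<Delta>\<^esub> d \<otimes>\<^bsub>\<Delta>\<^esub> inv\<^bsub>\<Delta>\<^esub> g) (\<phi> x)"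
    using assms(4) unfolding weakly_equivariant_def by blast
  have "\<psi> (\<beta> d y) = \<alpha> (inv\<^bsub>\<Delta>\<^esub> g \<otimes>\<^bsub>\<Delta>\<^esub> d \<otimes>\<^bsub>\<Delta>\<^esub> inv\<^bsub>\<Delta>\<^esub> (inv\<^bsub>\<Delta>\<^esub> g)) (\<psi> y)"
    if y: "y \<in> Y" and d: "d \<in> carrier \<Delta>" for y d
  proof -
    let ?x = "inv_into X \<phi> y" and ?d = "inv\<^bsub>\<Delta>\<^esub> g \<otimes>\<^bsub>\<Delta>\<^esub> d \<otimes>\<^bsub>\<Delta>\<^esub> g"
    have x: "?x \<in> X" "\<phi> ?x = y"
      using assms(5) y by (auto simp: bij_betw_def inv_into_into f_inv_into_f)
    have dd: "?d \<in> carrier \<Delta>" using d g by auto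
    have "g \<otimes>\<^bsub>\<Delta>\<^esub> ?d \<otimes>\<^bsub>\<Delta>\<^esub> inv\<^bsub>\<Delta>\<^esub> g = d" using d g by (simp add: m_assoc) (simp add: m_assoc[symmetric])
    then have "\<phi> (\<alpha> ?d ?x) = \<beta> d y" using g(2)[OF x(1) dd] x by simp
    moreover have "\<alpha> ?d ?x \<in> X" using A.element_image[OF dd x(1)] by auto
    ultimately have "inv_into X \<phi> (\<beta> d y) = \<alpha> ?d ?x"
      using assms(5) by (metis bij_betw_def inv_into_f_f)
    moreover have "\<beta> d y \<in> Y" using B.element_image[OF d y] by auto
    ultimately show ?thesis using y g assms(6) by simp
  qed
  then show ?thesis unfolding weakly_equivariant_def using g by (intro bexI[of _ "inv\<^bsub>\<Delta>\<^esub> g"]) auto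
qed

lemma weakly_equivariant_cong:
  assumes "group_action \<Delta> X \<alpha>" "\<And>x. x \<in> X \<Longrightarrow> \<phi> x = \<psi> x"
  shows "weakly_equivariant \<Delta> X \<alpha> \<beta> \<phi> \<longleftrightarrow> weakly_equivariant \<Delta> X \<alpha> \<beta> \<psi>"
proof -
  interpret A: group_action \<Delta> X \<alpha> by fact
  have "\<And>d x. d \<in> carrier \<Delta> \<Longrightarrow> x \<in> X \<Longrightarrow> \<alpha> d x \<in> X" using A.element_image by blast
  then show ?thesis unfolding weakly_equivariant_def using assms(2) by (simp cong: bex_cong)
qed

lemma group_action_imp_group: "group_action \<Delta> X \<alpha> \<Longrightarrow> group \<Delta>"
  by (simp add: group_action_def group_hom_def)

theorem group_sr_Aut:
  assumes G: "is_sr_graph C D G"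
  shows "group (sr_Aut D G)"
proof -
  let ?V = "verts G" and ?E = "arcs G"
  have wf: "\<And>e. e \<in> ?E \<Longrightarrow> tail G e \<in> ?V \<and> head G e \<in> ?V \<and> ebar G e \<in> ?E"
    using G wf_digraph.tail_in_verts[of "digr G"] wf_digraph.head_in_verts[of "digr G"]
    unfolding is_sr_graph_def is_graph_def by (auto simp: pre_digraph.defs)
  have act: "\<And>v. v \<in> ?V \<Longrightarrow> group_action (grp D (vcol G v)) (star G v) (act G v)"
    using G unfolding is_sr_graph_def by auto
  note grpv = group_action_imp_group[OF act]
  have starE: "\<And>v. star G v \<subseteq> ?E" by (auto simp: star_def)
  let ?A = "sr_Aut D G"
  have closed: "f \<otimes>\<^bsub>?A\<^esub> g \<in> carrier ?A" if f: "f \<in> carrier ?A" and g: "g \<in> carrier ?A" for f g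
  proof -
    obtain fV fE gV gE where fg: "f = (fV,fE)" "g = (gV,gE)" by fastforce
    have b: "fV \<in> Bij ?V" "fE \<in> Bij ?E" "gV \<in> Bij ?V" "gE \<in> Bij ?E" "sr_morphism D G G fV fE" "sr_morphism D G G gV gE"
      using f g unfolding fg sr_Aut_def by auto
    have m: "\<And>v. v \<in> ?V \<Longrightarrow> gV v \<in> ?V" "\<And>v. v \<in> ?E \<Longrightarrow> gE v \<in> ?E" using b Bij_imp_funcset by blast+
    have "graph_hom G G (compose ?V fV gV) (compose ?E fE gE)"
      using b m wf unfolding sr_morphism_def graph_hom_def by (auto simp: compose_def)
    moreover have "weakly_equivariant (grp D (vcol G v)) (star G v) (act G v) (act G (compose ?V fV gV v)) (compose ?E fE gE)"
      and "bij_betw (compose ?E fE gE) (star G v) (star G (compose ?V fV gV v))" if v: "v \<in> ?V" for v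
    proof -
      have 1: "bij_betw gE (star G v) (star G (gV v))" "bij_betw fE (star G (gV v)) (star G (fV (gV v)))"
        using b m v unfolding sr_morphism_def by auto
      have 3: "\<And>x. x \<in> star G v \<Longrightarrow> compose ?E fE gE x = fE (gE x)" using starE by (auto simp: compose_def)
      have 2: "weakly_equivariant (grp D (vcol G v)) (star G v) (act G v) (act G (gV v)) gE"
        "weakly_equivariant (grp D (vcol G v)) (star G (gV v)) (act G (gV v)) (act G (fV (gV v))) fE"
        using b m v unfolding sr_morphism_def by metis+
      show "weakly_equivariant (grp D (vcol G v)) (star G v) (act G v) (act G (compose ?V fV gV v)) (compose ?E fE gE)"
        using weakly_equivariant_comp[OF grpv[OF v] 2] 1 v 3
        by (subst weakly_equivariant_cong[OF act[OF v] 3]) (auto simp: compose_def bij_betw_def)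
      show "bij_betw (compose ?E fE gE) (star G v) (star G (compose ?V fV gV v))"
      proof -
        have "bij_betw (compose ?E fE gE) (star G v) (star G (fV (gV v)))"
          using bij_betw_trans[OF 1] bij_betw_cong[of "star G v" "compose ?E fE gE" "fE \<circ> gE"] 3 by simp
        then show ?thesis using v by (simp add: compose_eq)
      qed
    qed
    moreover have "\<And>v. v \<in> ?V \<Longrightarrow> vcol G (compose ?V fV gV v) = vcol G v"
      "\<And>e. e \<in> ?E \<Longrightarrow> ecol G (compose ?E fE gE e) = ecol G e"
      using b m unfolding sr_morphism_def by (metis compose_eq)+
    ultimately have "sr_morphism D G G (compose ?V fV gV) (compose ?E fE gE)"
      unfolding sr_morphism_def by blast
    then show ?thesis using b unfolding fg sr_Aut_def by (auto intro: compose_Bij)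
  qed
  have one: "\<one>\<^bsub>?A\<^esub> \<in> carrier ?A"
  proof -
    have "weakly_equivariant (grp D (vcol G v)) (star G v) (act G v) (act G v) (\<lambda>e\<in>?E. e)"
      "bij_betw (\<lambda>e\<in>?E. e) (star G v) (star G v)"
      if v: "v \<in> ?V" for v
    proof -
      have r: "\<And>e. e \<in> star G v \<Longrightarrow> (\<lambda>e\<in>?E. e) e = e" using starE by auto
      show "weakly_equivariant (grp D (vcol G v)) (star G v) (act G v) (act G v) (\<lambda>e\<in>?E. e)"
        using weakly_equivariant_id[OF grpv[OF v]] by (subst weakly_equivariant_cong[OF act[OF v] r])
      show "bij_betw (\<lambda>e\<in>?E. e) (star G v) (star G v)"
        using bij_betw_cong[of "star G v" "\<lambda>e\<in>?E. e" id] r by simp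
    qed
    then show ?thesis using wf unfolding sr_Aut_def sr_morphism_def graph_hom_def
      by (auto simp: id_Bij)
  qed
  have inv: "\<exists>g\<in>carrier ?A. g \<otimes>\<^bsub>?A\<^esub> f = \<one>\<^bsub>?A\<^esub>" if f: "f \<in> carrier ?A" for f
  proof -
    obtain fV fE where fg: "f = (fV,fE)" by fastforce
    have b: "fV \<in> Bij ?V" "fE \<in> Bij ?E" "sr_morphism D G G fV fE"
      using f unfolding fg sr_Aut_def by auto
    define gV where "gV = (\<lambda>v\<in>?V. inv_into ?V fV v)"
    define gE where "gE = (\<lambda>v\<in>?E. inv_into ?E fE v)"
    have gb: "gV \<in> Bij ?V" "gE \<in> Bij ?E" unfolding gV_def gE_def by (rule restrict_inv_into_Bij; fact)+
    have m: "\<And>v. v \<in> ?V \<Longrightarrow> gV v \<in> ?V" "\<And>v. v \<in> ?E \<Longrightarrow> gE v \<in> ?E" 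
       "\<And>v. v \<in> ?V \<Longrightarrow> fV v \<in> ?V" "\<And>v. v \<in> ?E \<Longrightarrow> fE v \<in> ?E"
      using b gb Bij_imp_funcset by blast+
    have bb: "bij_betw fV ?V ?V" "bij_betw fE ?E ?E" using b by (auto simp: Bij_def)
    have fi: "\<And>v. v \<in> ?V \<Longrightarrow> fV (gV v) = v" "\<And>v. v \<in> ?E \<Longrightarrow> fE (gE v) = v"
      "\<And>v. v \<in> ?V \<Longrightarrow> gV (fV v) = v" "\<And>v. v \<in> ?E \<Longrightarrow> gE (fE v) = v"
      using m bb unfolding gV_def gE_def by (auto simp: bij_betw_def f_inv_into_f)
    have h: "graph_hom G G fV fE" using b by (auto simp: sr_morphism_def)
    have hg: "graph_hom G G gV gE" unfolding graph_hom_def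
    proof (intro conjI ballI)
      fix e assume e: "e \<in> ?E"
      have "tail G (fE (gE e)) = fV (tail G (gE e))" "head G (fE (gE e)) = fV (head G (gE e))" 
         "ebar G (fE (gE e)) = fE (ebar G (gE e))" using h m e unfolding graph_hom_def by auto
      then show "tail G (gE e) = gV (tail G e)" "head G (gE e) = gV (head G e)" 
         "ebar G (gE e) = gE (ebar G e)" using e wf m fi by auto
    qed (use m in auto)
    have col: "\<And>v. v \<in> ?V \<Longrightarrow> vcol G (gV v) = vcol G v" "\<And>v. v \<in> ?E \<Longrightarrow> ecol G (gE v) = ecol G v"
      using b m fi unfolding sr_morphism_def by metis+
    have "weakly_equivariant (grp D (vcol G v)) (star G v) (act G v) (act G (gV v)) gE"
      and "bij_betw gE (star G v) (star G (gV v))" if v: "v \<in> ?V" for v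
    proof -
      let ?w = "gV v"
      have w: "?w \<in> ?V" "fV ?w = v" using m fi v by auto
      have B: "bij_betw fE (star G ?w) (star G v)" using b w unfolding sr_morphism_def by metis
      have W: "weakly_equivariant (grp D (vcol G v)) (star G ?w) (act G ?w) (act G v) fE"
        using b w col(1)[OF v] unfolding sr_morphism_def by metis
      have A: "group_action (grp D (vcol G v)) (star G ?w) (act G ?w)" using act[OF w(1)] col(1)[OF v] by simp
      have "gE y = inv_into (star G ?w) fE y" if "y \<in> star G v" for y
      proof -
        obtain x where x: "x \<in> star G ?w" "y = fE x" using B \<open>y \<in> star G v\<close> by (auto simp: bij_betw_def)
        then have "inv_into (star G ?w) fE y = x" using B by (auto simp: bij_betw_def)
        then show ?thesis using x starE fi(4) by (metis subsetD)
      qed note e = this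
      show "weakly_equivariant (grp D (vcol G v)) (star G v) (act G v) (act G (gV v)) gE"
        by (rule weakly_equivariant_inv[OF grpv[OF v] A act[OF v] W B e])
      show "bij_betw gE (star G v) (star G (gV v))"
        using bij_betw_inv_into[OF B] bij_betw_cong[of "star G v" gE "inv_into (star G ?w) fE"] e by simp
    qed
    then have "(gV,gE) \<in> carrier ?A" using gb hg col by (auto simp: sr_Aut_def sr_morphism_def)
    moreover have "(gV,gE) \<otimes>\<^bsub>?A\<^esub> f = \<one>\<^bsub>?A\<^esub>"
      using fi(3,4) by (simp add: sr_Aut_def fg compose_def cong: restrict_cong)
    ultimately show ?thesis by blast
  qed
  show ?thesis
  proof (rule groupI)
    fix x y z assume "x \<in> carrier ?A" "y \<in> carrier ?A" "z \<in> carrier ?A"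
    then show "x \<otimes>\<^bsub>?A\<^esub> y \<otimes>\<^bsub>?A\<^esub> z = x \<otimes>\<^bsub>?A\<^esub> (y \<otimes>\<^bsub>?A\<^esub> z)"
      by (simp add: sr_Aut_def compose_assoc[OF Bij_imp_funcset])
  next
    fix x assume "x \<in> carrier ?A"
    then show "\<one>\<^bsub>?A\<^esub> \<otimes>\<^bsub>?A\<^esub> x = x"
      by (auto simp: sr_Aut_def Bij_imp_funcset Bij_imp_extensional)
  qed (use closed one inv in auto)
qed

section \<open>Quotients and free actions\<close>

(* Vertices and edges of the quotient are the orbits.  The tail, the head and the inverse
   of the orbit of e are the images of this orbit under tail, head and ebar, that is, the
   orbits of tail e, head e and ebar e. *)
definition quotient_graph ::
  "('i, 'k, 'd, 'x) sr_data \<Rightarrow> ('v, 'e, 'i, 'k, 'd) sr_graph \<Rightarrow>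
   (('v \<Rightarrow> 'v) \<times> ('e \<Rightarrow> 'e)) set \<Rightarrow> ('v set, 'e set) igraph" where
  "quotient_graph D G H =
     \<lparr>verts = Group_Action.orbits (sr_Aut D G\<lparr>carrier := H\<rparr>) (verts G) fst,
      arcs = Group_Action.orbits (sr_Aut D G\<lparr>carrier := H\<rparr>) (arcs G) snd,
      tail = (\<lambda>a. tail G ` a),
      head = (\<lambda>a. head G ` a),
      ebar = (\<lambda>a. ebar G ` a)\<rparr>"

(* The coloring is constant on orbits; the induced map takes an orbit to its only color. *)
definition coloring_induces_iso ::
  "('i, 'k) igraph \<Rightarrow> ('i, 'k, 'd, 'x) sr_data \<Rightarrow> ('v, 'e, 'i, 'k, 'd) sr_graph \<Rightarrow>
   (('v \<Rightarrow> 'v) \<times> ('e \<Rightarrow> 'e)) set \<Rightarrow> bool" where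
  "coloring_induces_iso C D G H \<longleftrightarrow>
     graph_iso (quotient_graph D G H) C
       (\<lambda>a. the_elem (vcol G ` a)) (\<lambda>a. the_elem (ecol G ` a))"

(* Points of the 1-complex: Interior e t is the point at parameter t on the edge e
   traversed from tail to head, so that Interior e t and Interior (ebar e) (1 - t) are
   the same point. *)
datatype ('v, 'e) point = Vertex 'v | Interior 'e real

definition points :: "('v, 'e, 'z) igraph_scheme \<Rightarrow> ('v, 'e) point set" where
  "points G = Vertex ` verts G \<union> {Interior e t |e t. e \<in> arcs G \<and> 0 < t \<and> t < 1}"

definition same_point :: "('v, 'e, 'z) igraph_scheme \<Rightarrow> ('v, 'e) point \<Rightarrow> ('v, 'e) point \<Rightarrow> bool" where
  "same_point G p q \<longleftrightarrow> p = q \<or> (\<exists>e t. p = Interior e t \<and> q = Interior (ebar G e) (1 - t))"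

definition acts_freely ::
  "('i, 'k, 'd, 'x) sr_data \<Rightarrow> ('v, 'e, 'i, 'k, 'd) sr_graph \<Rightarrow>
   (('v \<Rightarrow> 'v) \<times> ('e \<Rightarrow> 'e)) set \<Rightarrow> bool" where
  "acts_freely D G \<Gamma> \<longleftrightarrow>
     (\<forall>\<gamma>\<in>\<Gamma>. \<gamma> \<noteq> \<one>\<^bsub>sr_Aut D G\<^esub> \<longrightarrow>
        (\<forall>p\<in>points G. \<not> same_point G (map_point (fst \<gamma>) (snd \<gamma>) p) p))"

end

theory Submission
  imports Defs
begin

text \<open>
  Freeness of \<open>\<Gamma>\<close> gives elements \<open>s v\<close> of \<open>\<Gamma>\<close>, with \<open>s (\<gamma> v) \<gamma> = s v\<close>, which move every
  vertex \<open>v\<close> to a fixed representative of its \<open>\<Gamma>\<close>-orbit.  For an edge \<open>e\<close> from \<open>v\<close> to \<open>w\<close>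
  the edges \<open>s v e\<close> and \<open>s w e\<close> have the same color, hence some \<open>t e \<in> H\<close> takes the second to
  the first; \<open>t e\<close> can be chosen to depend only on these two edges, so that \<open>t\<close> is
  \<open>\<Gamma>\<close>-invariant, and, as \<open>C\<close> has no loops, with \<open>t (ebar e) = inv (t e)\<close>.  Since \<open>T\<close> is a tree,
  the products of \<open>t\<close> along walks from a base vertex \<open>v0\<close> define \<open>h v \<in> H\<close> with
  \<open>h w = h v \<otimes> t e\<close>.  Then \<open>h v \<otimes> s v\<close> and \<open>h w \<otimes> s w\<close> agree on \<open>e\<close>, so
  that the maps \<open>h v \<otimes> s v\<close> on the stars of the vertices \<open>v\<close> fit together to a locally bijective
  map \<open>g\<close> from \<open>T\<close> to itself, which is an automorphism, \<open>T\<close> being a tree.  Invariance of \<open>t\<close>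
  gives \<open>h (\<gamma> v) = h (\<gamma> v0) \<otimes> h v\<close>, and therefore \<open>g \<otimes> \<gamma> = h (\<gamma> v0) \<otimes> g\<close>.
\<close>

section \<open>Walks and trees\<close>

abbreviation walk :: "('v, 'e, 'z) igraph_scheme \<Rightarrow> 'v \<Rightarrow> 'e list \<Rightarrow> 'v \<Rightarrow> bool" where
  "walk G \<equiv> pre_digraph.awalk (digr G)"

lemma graph_arcD:
  assumes "is_graph G" "e \<in> arcs G"
  shows "tail G e \<in> verts G" "head G e \<in> verts G" "ebar G e \<in> arcs G"
    "ebar G (ebar G e) = e" "tail G (ebar G e) = head G e" "head G (ebar G e) = tail G e"
proof -
  have inv: "\<forall>e\<in>arcs G. ebar G e \<in> arcs G \<and> ebar G (ebar G e) = e \<and> tail G (ebar G e) = head G e"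
    and wf: "wf_digraph (digr G)"
    using assms(1) unfolding is_graph_def by auto
  show "tail G e \<in> verts G" "head G e \<in> verts G"
    using wf_digraph.tail_in_verts[OF wf, of e] wf_digraph.head_in_verts[OF wf, of e] assms(2)
    by (auto simp: pre_digraph.defs)
  show "ebar G e \<in> arcs G" "ebar G (ebar G e) = e" "tail G (ebar G e) = head G e"
    "head G (ebar G e) = tail G e"
    using inv assms(2) by metis+
qed

lemma walk_Nil_iff: "walk G u [] v \<longleftrightarrow> u = v \<and> u \<in> verts G"
  by (auto simp: pre_digraph.awalk_def pre_digraph.cas.simps pre_digraph.defs)

lemma walk_Cons_iff:
  assumes "is_graph G"
  shows "walk G u (e # p) w \<longleftrightarrow> e \<in> arcs G \<and> tail G e = u \<and> walk G (head G e) p w"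
  using graph_arcD[OF assms, of e]
  by (auto simp: pre_digraph.awalk_def pre_digraph.cas.simps pre_digraph.defs)

lemma walk_verts:
  assumes "is_graph G" "walk G u p v"
  shows "u \<in> verts G" "v \<in> verts G"
  using assms(2) graph_arcD[OF assms(1)]
  by (induction p arbitrary: u) (auto simp: walk_Nil_iff walk_Cons_iff[OF assms(1)])

lemma walk_append_iff:
  assumes "is_graph G"
  shows "walk G u (p @ q) w \<longleftrightarrow> (\<exists>v. walk G u p v \<and> walk G v q w)"
  using walk_verts[OF assms]
  by (induction p arbitrary: u) (auto simp: walk_Nil_iff walk_Cons_iff[OF assms])

lemma walk_delete_backtrack:
  assumes "is_graph G" "walk G u (p @ e # ebar G e # q) v"
  shows "walk G u (p @ q) v"
  using assms(2) graph_arcD[OF assms(1)]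
  by (auto simp: walk_append_iff[OF assms(1)] walk_Cons_iff[OF assms(1)])

lemma walk_exists:
  assumes G: "is_graph G" and "u \<in> verts G" "v \<in> verts G"
  shows "\<exists>p. walk G u p v"
proof -
  have wf: "wf_digraph (digr G)" and con: "Digraph_Component.connected (digr G)"
    using G unfolding is_graph_def by auto
  interpret wf_digraph "digr G" by fact
  \<comment> \<open>Connectedness is defined through the symmetric closure. Inverse edges make the
    digraph symmetric already, so reachability in the closure yields directed walks in
    \<open>G\<close>.\<close>
  have "symmetric (digr G)"
    unfolding symmetric_def
  proof (rule symI)
    fix a b assume "(a, b) \<in> arcs_ends (digr G)"
    then obtain e where e: "e \<in> arcs G" "a = tail G e" "b = head G e"
      by (auto simp: arcs_ends_def arc_to_ends_def pre_digraph.defs)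
    then have "ebar G e \<in> arcs G" "tail G (ebar G e) = b" "head G (ebar G e) = a"
      using graph_arcD[OF G] by auto
    then show "(b, a) \<in> arcs_ends (digr G)"
      by (force simp: arcs_ends_def arc_to_ends_def pre_digraph.defs)
  qed
  moreover have "u \<in> verts (mk_symmetric (digr G))" "v \<in> verts (mk_symmetric (digr G))"
    using assms(2,3) by (auto simp: mk_symmetric_def pre_digraph.defs)
  ultimately show ?thesis
    using con unfolding connected_def strongly_connected_def
    by (metis reachable_mk_symmetric_eq reachable_awalk)
qed

text \<open>Induction along a walk from \<open>u\<close> to \<open>v\<close>. It later spreads
  membership and equations from one vertex to the whole graph.\<close>

lemma graph_induct:
  assumes "is_graph G" "u \<in> verts G" "v \<in> verts G" "P u"
    and "\<And>e. e \<in> arcs G \<Longrightarrow> P (tail G e) \<Longrightarrow> P (head G e)"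
  shows "P v"
proof -
  obtain p where "walk G u p v" using walk_exists assms by metis
  then show ?thesis using assms(4,5)
    by (induction p arbitrary: u) (auto simp: walk_Nil_iff walk_Cons_iff[OF assms(1)])
qed

lemma graph_verts_nonempty: "is_graph G \<Longrightarrow> verts G \<noteq> {}"
  by (auto simp: is_graph_def connected_def strongly_connected_def mk_symmetric_def pre_digraph.defs)

section \<open>Closed walks in trees and products along walks\<close>

lemma not_successively_split:
  "\<not> successively P xs \<Longrightarrow> \<exists>ys x y zs. xs = ys @ x # y # zs \<and> \<not> P x y"
proof (induction P xs rule: successively.induct)
  case (3 P x y xs)
  show ?case
  proof (cases "P x y")
    case True
    then obtain ys a b zs where "y # xs = ys @ a # b # zs" "\<not> P a b" using 3 by auto
    then have "x # y # xs = (x # ys) @ a # b # zs" by simp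
    then show ?thesis using \<open>\<not> P a b\<close> by blast
  next
    case False
    then show ?thesis by (metis append_Nil)
  qed
qed auto

lemma tree_closed_walk_backtracks:
  assumes "is_tree G" "walk G u p u" "p \<noteq> []"
  obtains q e r where "p = q @ e # ebar G e # r"
  using assms not_successively_split[of "\<lambda>e f. f \<noteq> ebar G e" p] unfolding is_tree_def by blast

text \<open>Deleting a backtrack does not change the product of the labels along a walk, because
  \<open>t (ebar G e)\<close> is the inverse of \<open>t e\<close>. In a tree every closed walk
  reduces to the empty one by such deletions, so the product depends only on the endpoints, and
  \<open>h v\<close> is the product along any walk from \<open>v0\<close> to
  \<open>v\<close>.\<close>

lemma tree_potential:
  fixes K (structure)
  assumes "group K" and G: "is_tree G" and v0: "v0 \<in> verts G"
    and t: "\<And>e. e \<in> arcs G \<Longrightarrow> t e \<in> carrier K"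
    and t_inv: "\<And>e. e \<in> arcs G \<Longrightarrow> t (ebar G e) = inv (t e)"
  shows "\<exists>h. h v0 = \<one> \<and> (\<forall>v\<in>verts G. h v \<in> carrier K) \<and>
    (\<forall>e\<in>arcs G. h (head G e) = h (tail G e) \<otimes> t e)"
proof -
  interpret group K by fact
  have gr: "is_graph G" using G unfolding is_tree_def by auto
  note walk_simps = walk_Nil_iff walk_Cons_iff[OF gr] walk_append_iff[OF gr]
  \<comment> \<open>Labels are multiplied in walk order, so that appending an edge multiplies by its
    label on the right.\<close>
  define hol where "hol p = foldr (\<lambda>e k. t e \<otimes> k) p \<one>" for p
  have hol_simps: "hol [] = \<one>" "\<And>e p. hol (e # p) = t e \<otimes> hol p"
    by (simp_all add: hol_def)
  have hol_closed: "hol p \<in> carrier K" if "walk G u p v" for u p v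
    using that t by (induction p arbitrary: u) (auto simp: hol_simps walk_simps)
  have hol_append: "hol (p @ q) = hol p \<otimes> hol q" if "walk G u p v" "walk G v q w" for u v w p q
    using that t hol_closed
    by (induction p arbitrary: u) (auto simp: hol_simps walk_simps m_assoc)
  have hol_closed_walk: "hol p = \<one>" if "walk G u p u" for u p
    using that
  proof (induction p rule: length_induct)
    case (1 p)
    show ?case
    proof (cases "p = []")
      case False
      then obtain q e r where p: "p = q @ e # ebar G e # r"
        using tree_closed_walk_backtracks[OF G "1.prems"] by blast
      then have "walk G u (q @ r) u" using walk_delete_backtrack[OF gr] "1.prems" by metis
      then have IH: "hol (q @ r) = \<one>" using "1.IH" p by simp
      obtain v where v: "walk G u q v" "walk G v (e # ebar G e # r) u"
        using "1.prems" p by (auto simp: walk_append_iff[OF gr])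
      then have e: "e \<in> arcs G" and r: "walk G v r u"
        using graph_arcD[OF gr] by (auto simp: walk_simps)
      have "t e \<otimes> (inv (t e) \<otimes> hol r) = hol r"
        using t[OF e] hol_closed[OF r] by (simp add: m_assoc[symmetric])
      then have "hol p = hol q \<otimes> hol r"
        using p hol_append[OF v] by (simp add: hol_simps t_inv[OF e])
      then show ?thesis using IH hol_append[OF v(1) r] by simp
    qed (simp add: hol_simps)
  qed
  \<comment> \<open>A common return walk \<open>r\<close> closes up both walks, and its product
    cancels on the right.\<close>
  have hol_unique: "hol p = hol q" if p: "walk G u p v" and q: "walk G u q v" for u v p q
  proof -
    obtain r where r: "walk G v r u" using walk_exists gr walk_verts[OF gr p] by metis
    have "hol p \<otimes> hol r = \<one>" "hol q \<otimes> hol r = \<one>"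
      using hol_append[OF p r] hol_append[OF q r] hol_closed_walk p q r
      by (metis walk_append_iff[OF gr])+
    then show ?thesis using hol_closed[OF p] hol_closed[OF q] hol_closed[OF r] by (metis right_cancel)
  qed
  define h where "h v = hol (SOME p. walk G v0 p v)" for v
  have h: "h v = hol p" if "walk G v0 p v" for v p
    unfolding h_def using someI[of "\<lambda>p. walk G v0 p v", OF that] that by (rule hol_unique)
  show ?thesis
  proof (intro exI[of _ h] conjI ballI)
    show "h v0 = \<one>" using h[of "[]" v0] v0 by (simp add: walk_Nil_iff hol_simps)
  next
    fix v assume "v \<in> verts G"
    then obtain p where "walk G v0 p v" using walk_exists gr v0 by metis
    then show "h v \<in> carrier K" using h hol_closed by metis
  next
    fix e assume e: "e \<in> arcs G"
    note ends = graph_arcD(1,2)[OF gr e]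
    obtain p where p: "walk G v0 p (tail G e)" using walk_exists gr v0 ends by metis
    have 1: "walk G (tail G e) [e] (head G e)" using e ends by (simp add: walk_simps)
    have "h (head G e) = hol (p @ [e])" using p 1 by (intro h) (metis walk_append_iff[OF gr])
    also have "\<dots> = hol p \<otimes> t e" using hol_append[OF p 1] t[OF e] by (simp add: hol_simps)
    finally show "h (head G e) = h (tail G e) \<otimes> t e" using h[OF p] by simp
  qed
qed

section \<open>Locally bijective maps into trees\<close>

lemma graph_hom_walk:
  assumes "is_graph G" "is_graph G'" "graph_hom G G' fV fE" "walk G u p v"
  shows "walk G' (fV u) (map fE p) (fV v)"
  using assms(4,3)
  by (induction p arbitrary: u)
    (auto simp: walk_Nil_iff walk_Cons_iff[OF assms(1)] walk_Cons_iff[OF assms(2)] graph_hom_def)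

text \<open>A tree has no proper connected covering. For injectivity, a walk between two vertices
  with the same image maps to a closed walk; its backtrack lifts, and deleting it shortens the walk
  until the endpoints coincide. For surjectivity, edges of \<open>G'\<close> lift one after the
  other along walks.\<close>

lemma tree_local_iso_imp_iso:
  assumes G: "is_graph G" and G': "is_tree G'" and hom: "graph_hom G G' fV fE"
    and star: "\<And>v. v \<in> verts G \<Longrightarrow> bij_betw fE (star G v) (star G' (fV v))"
  shows "graph_iso G G' fV fE"
proof -
  have gr': "is_graph G'" using G' unfolding is_tree_def by auto
  have fV: "\<And>v. v \<in> verts G \<Longrightarrow> fV v \<in> verts G'" and fE: "\<And>e. e \<in> arcs G \<Longrightarrow> fE e \<in> arcs G'"
    and f_ends: "\<And>e. e \<in> arcs G \<Longrightarrow> tail G' (fE e) = fV (tail G e)"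
      "\<And>e. e \<in> arcs G \<Longrightarrow> head G' (fE e) = fV (head G e)"
      "\<And>e. e \<in> arcs G \<Longrightarrow> ebar G' (fE e) = fE (ebar G e)"
    using hom unfolding graph_hom_def by auto
  have star_inj: "e = f" if "e \<in> arcs G" "f \<in> arcs G" "tail G e = tail G f" "fE e = fE f" for e f
    using star[OF graph_arcD(1)[OF G that(1)]] that
    by (auto simp: bij_betw_def inj_on_def star_def)
  have inj_walk: "u = v" if "walk G u p v" "fV u = fV v" for u p v
    using that
  proof (induction p rule: length_induct)
    case (1 p)
    show ?case
    proof (cases "p = []")
      case False
      have "walk G' (fV u) (map fE p) (fV u)"
        using graph_hom_walk[OF G gr' hom "1.prems"(1)] "1.prems"(2) by simp
      then obtain q' e' r' where "map fE p = q' @ e' # ebar G' e' # r'"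
        using tree_closed_walk_backtracks[OF G'] False by (metis map_is_Nil_conv)
      then obtain q e f r where p: "p = q @ e # f # r" and ef: "fE f = ebar G' (fE e)"
        by (auto simp: map_eq_append_conv map_eq_Cons_conv append_eq_map_conv Cons_eq_map_conv)
      have "e \<in> arcs G" "f \<in> arcs G" "tail G f = head G e"
        using "1.prems"(1) p by (auto simp: walk_append_iff[OF G] walk_Cons_iff[OF G])
      \<comment> \<open>Both edges leave the head of \<open>e\<close> and have the same image, so
        injectivity on this star identifies them.\<close>
      then have "f = ebar G e"
        using star_inj f_ends ef graph_arcD[OF G] by metis
      then have "walk G u (q @ r) v" using walk_delete_backtrack[OF G] "1.prems"(1) p by metis
      then show ?thesis using "1.IH"[rule_format, of "q @ r"] "1.prems"(2) p by simp
    qed (use "1.prems" in \<open>simp add: walk_Nil_iff\<close>)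
  qed
  then have inj_V: "inj_on fV (verts G)" using walk_exists[OF G] by (metis inj_onI)
  have inj_E: "inj_on fE (arcs G)"
    using inj_V star_inj f_ends(1) graph_arcD(1)[OF G] by (metis inj_onI inj_onD)
  obtain v0 where v0: "v0 \<in> verts G" using graph_verts_nonempty[OF G] by blast
  have lift: "\<exists>f\<in>arcs G. fE f = e" if "e \<in> arcs G'" "tail G' e \<in> fV ` verts G" for e
  proof -
    obtain v where "v \<in> verts G" "tail G' e = fV v" using \<open>tail G' e \<in> fV ` verts G\<close> by auto
    then have "e \<in> fE ` star G v" using star \<open>e \<in> arcs G'\<close> by (auto simp: bij_betw_def star_def)
    then show ?thesis by (auto simp: star_def)
  qed
  have surj_V: "v \<in> fV ` verts G" if "v \<in> verts G'" for v
  proof (rule graph_induct[OF gr' fV[OF v0] that])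
    show "fV v0 \<in> fV ` verts G" using v0 by blast
    show "head G' e \<in> fV ` verts G" if "e \<in> arcs G'" "tail G' e \<in> fV ` verts G" for e
      using lift[OF that] f_ends(2) graph_arcD(2)[OF G] by auto
  qed
  have "fE ` arcs G = arcs G'"
    using fE lift surj_V graph_arcD(1)[OF gr'] by blast
  moreover have "fV ` verts G = verts G'" using fV surj_V by blast
  ultimately show ?thesis
    using hom inj_V inj_E unfolding graph_iso_def bij_betw_def by blast
qed

section \<open>Orientations\<close>

text \<open>A loop would have to lie both in \<open>P\<close> and outside it; without loops an edge
  and its inverse are two edges, and one of them is selected.\<close>

lemma no_loops_orientation:
  assumes "is_graph G" "no_loops G"
  obtains P where "\<And>e. e \<in> arcs G \<Longrightarrow> ebar G e \<in> P \<longleftrightarrow> e \<notin> P"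
proof -
  \<comment> \<open>The choice is made from the unordered pair, so that an edge and its inverse
    select the same member.\<close>
  define c where "c e = (SOME f. f \<in> {e, ebar G e})" for e
  have c: "c (ebar G e) = c e" "c e \<in> {e, ebar G e}" "ebar G e \<noteq> e" if "e \<in> arcs G" for e
  proof -
    have "{ebar G e, ebar G (ebar G e)} = {e, ebar G e}" using graph_arcD[OF assms(1) that] by auto
    then show "c (ebar G e) = c e" by (simp only: c_def)
    show "c e \<in> {e, ebar G e}" unfolding c_def by (rule someI[of _ e]) simp
    show "ebar G e \<noteq> e" using assms(2) that unfolding no_loops_def by blast
  qed
  then have "ebar G e \<in> {e. c e = e} \<longleftrightarrow> e \<notin> {e. c e = e}" if "e \<in> arcs G" for e
    using c[OF that] unfolding mem_Collect_eq insert_iff empty_iff by metis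
  then show thesis by (rule that[of "{e. c e = e}"])
qed

section \<open>Automorphisms of symmetry-restricted graphs\<close>

locale symmetry_restricted_graph =
  fixes C :: "('i, 'k) igraph"
    and D :: "('i, 'k, 'd, 'x) sr_data"
    and G :: "('v, 'e, 'i, 'k, 'd) sr_graph"
  assumes sr: "is_sr_graph C D G"
begin

abbreviation Aut where "Aut \<equiv> sr_Aut D G"

sublocale group Aut by (rule group_sr_Aut[OF sr])

lemma graph: "is_graph G"
  using sr unfolding is_sr_graph_def by auto

lemmas arcD = graph_arcD[OF graph]

section \<open>Pointwise rules and gluing of automorphisms\<close>

lemma Aut_maps:
  assumes "x \<in> carrier Aut"
  shows "v \<in> verts G \<Longrightarrow> fst x v \<in> verts G" "e \<in> arcs G \<Longrightarrow> snd x e \<in> arcs G"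
  using assms Bij_imp_funcset unfolding sr_Aut_def by auto

lemma Aut_commutes:
  assumes "x \<in> carrier Aut" "e \<in> arcs G"
  shows "tail G (snd x e) = fst x (tail G e)" "head G (snd x e) = fst x (head G e)"
    "ebar G (snd x e) = snd x (ebar G e)" "ecol G (snd x e) = ecol G e"
  using assms unfolding sr_Aut_def sr_morphism_def graph_hom_def by auto

lemma Aut_mult:
  "v \<in> verts G \<Longrightarrow> fst (x \<otimes>\<^bsub>Aut\<^esub> y) v = fst x (fst y v)"
  "e \<in> arcs G \<Longrightarrow> snd (x \<otimes>\<^bsub>Aut\<^esub> y) e = snd x (snd y e)"
  unfolding sr_Aut_def by (auto simp: compose_eq)

lemma Aut_one:
  "v \<in> verts G \<Longrightarrow> fst \<one>\<^bsub>Aut\<^esub> v = v" "e \<in> arcs G \<Longrightarrow> snd \<one>\<^bsub>Aut\<^esub> e = e"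
  unfolding sr_Aut_def by auto

lemma Aut_inv:
  assumes "x \<in> carrier Aut"
  shows "v \<in> verts G \<Longrightarrow> fst (inv\<^bsub>Aut\<^esub> x) (fst x v) = v"
    "e \<in> arcs G \<Longrightarrow> snd (inv\<^bsub>Aut\<^esub> x) (snd x e) = e"
  using assms by (metis Aut_mult Aut_one l_inv)+

lemma Aut_eqI:
  assumes "x \<in> carrier Aut" "y \<in> carrier Aut"
    "\<And>v. v \<in> verts G \<Longrightarrow> fst x v = fst y v" "\<And>e. e \<in> arcs G \<Longrightarrow> snd x e = snd y e"
  shows "x = y"
proof (rule prod_eqI)
  have "fst x \<in> extensional (verts G)" "fst y \<in> extensional (verts G)"
    "snd x \<in> extensional (arcs G)" "snd y \<in> extensional (arcs G)"
    using assms(1,2) by (auto simp: sr_Aut_def intro: Bij_imp_extensional)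
  then show "fst x = fst y" "snd x = snd y" using assms(3,4) by (auto intro: extensionalityI)
qed

text \<open>Bijectivity and weak equivariance of a morphism are conditions on single stars, and on
  the star of \<open>v\<close> the glued map is the automorphism \<open>a v\<close>. Global
  bijectivity then comes from the tree.\<close>

lemma Aut_glue:
  assumes tree: "is_tree G"
    and a: "\<And>v. v \<in> verts G \<Longrightarrow> a v \<in> carrier Aut"
    and compat: "\<And>e. e \<in> arcs G \<Longrightarrow> snd (a (head G e)) e = snd (a (tail G e)) e"
  shows "\<exists>g\<in>carrier Aut. (\<forall>v\<in>verts G. fst g v = fst (a v) v) \<and>
    (\<forall>e\<in>arcs G. snd g e = snd (a (tail G e)) e)"
proof -
  define gV where "gV = (\<lambda>v\<in>verts G. fst (a v) v)"
  define gE where "gE = (\<lambda>e\<in>arcs G. snd (a (tail G e)) e)"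
  have gE_star: "gE e = snd (a v) e" if "e \<in> star G v" for e v
    using that by (auto simp: gE_def star_def)
  have hom: "graph_hom G G gV gE"
    unfolding graph_hom_def
  proof (intro conjI ballI)
    show "gV \<in> verts G \<rightarrow> verts G" "gE \<in> arcs G \<rightarrow> arcs G"
      using a Aut_maps arcD by (auto simp: gV_def gE_def)
    fix e assume e: "e \<in> arcs G"
    have at: "a (tail G e) \<in> carrier Aut" "a (head G e) \<in> carrier Aut" using a arcD e by auto
    show "tail G (gE e) = gV (tail G e)"
      using e at arcD[OF e] by (simp add: gE_def gV_def Aut_commutes)
    \<comment> \<open>By \<open>compat\<close> the image of \<open>e\<close> may be computed with
      the automorphism at its head, which is also the one that \<open>gV\<close> uses there and
      \<open>gE\<close> uses on \<open>ebar G e\<close>.\<close>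
    show "head G (gE e) = gV (head G e)"
      using e at arcD[OF e] compat[OF e, symmetric] by (simp add: gE_def gV_def Aut_commutes)
    show "ebar G (gE e) = gE (ebar G e)"
      using e at arcD[OF e] compat[OF e, symmetric] by (simp add: gE_def gV_def Aut_commutes)
  qed
  have star: "bij_betw gE (star G v) (star G (gV v))"
    and weq: "weakly_equivariant (grp D (vcol G v)) (star G v) (act G v) (act G (gV v)) gE"
    and vcol: "vcol G (gV v) = vcol G v" if v: "v \<in> verts G" for v
  proof -
    have m: "sr_morphism D G G (fst (a v)) (snd (a v))" using a[OF v] unfolding sr_Aut_def by auto
    have gV: "gV v = fst (a v) v" using v by (simp add: gV_def)
    show "bij_betw gE (star G v) (star G (gV v))"
      using m v gV gE_star bij_betw_cong[of "star G v" gE "snd (a v)"]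
      unfolding sr_morphism_def by simp
    have ga: "group_action (grp D (vcol G v)) (star G v) (act G v)"
      using sr v unfolding is_sr_graph_def by auto
    show "weakly_equivariant (grp D (vcol G v)) (star G v) (act G v) (act G (gV v)) gE"
      using m v gV weakly_equivariant_cong[OF ga gE_star] unfolding sr_morphism_def by simp
    show "vcol G (gV v) = vcol G v" using m v gV unfolding sr_morphism_def by auto
  qed
  have "ecol G (gE e) = ecol G e" if "e \<in> arcs G" for e
    using that a arcD by (simp add: gE_def Aut_commutes)
  then have "sr_morphism D G G gV gE"
    using hom star weq vcol unfolding sr_morphism_def by blast
  moreover have "graph_iso G G gV gE" using tree_local_iso_imp_iso[OF graph tree hom star] .
  ultimately have "(gV, gE) \<in> carrier Aut"
    unfolding sr_Aut_def graph_iso_def Bij_def by (auto simp: gV_def gE_def)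
  then show ?thesis by (intro bexI[of _ "(gV, gE)"]) (auto simp: gV_def gE_def)
qed

section \<open>Orbits of \<open>H\<close> and of \<open>\<Gamma>\<close>\<close>

text \<open>Colors are constant on orbits, and injectivity of the induced map on the edges of the
  quotient leaves only one \<open>H\<close>-orbit for each edge color.\<close>

lemma coloring_iso_transitive:
  assumes H: "subgroup H Aut" and iso: "coloring_induces_iso C D G H"
    and e: "e \<in> arcs G" and f: "f \<in> arcs G" and col: "ecol G e = ecol G f"
  shows "\<exists>h\<in>H. snd h e = f"
proof -
  interpret H: subgroup H Aut by fact
  define orbit_of where "orbit_of = orbit (Aut\<lparr>carrier := H\<rparr>) snd"
  have orbit_of: "orbit_of e = {snd h e |h. h \<in> H}" for e unfolding orbit_of_def orbit_def by simp
  have refl: "e \<in> orbit_of e" if "e \<in> arcs G" for e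
    using Aut_one(2)[OF that] unfolding orbit_of by (metis (mono_tags, lifting) H.one_closed mem_Collect_eq)
  have "ecol G ` orbit_of e = {ecol G e}" if "e \<in> arcs G" for e
    using refl[OF that] Aut_commutes(4)[OF H.mem_carrier that] by (auto simp: orbit_of)
  then have "the_elem (ecol G ` orbit_of e) = the_elem (ecol G ` orbit_of f)" using e f col by simp
  moreover have "inj_on (\<lambda>a. the_elem (ecol G ` a)) (arcs (quotient_graph D G H))"
    using iso unfolding coloring_induces_iso_def graph_iso_def bij_betw_def by blast
  moreover have "orbit_of e \<in> arcs (quotient_graph D G H)" "orbit_of f \<in> arcs (quotient_graph D G H)"
    using e f unfolding quotient_graph_def orbit_of_def orbits_def by auto
  ultimately have "orbit_of e = orbit_of f" by (meson inj_onD)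
  then have "f \<in> orbit_of e" using refl[OF f] by simp
  then show ?thesis unfolding orbit_of by blast
qed

lemma acts_freely_fixed_vertex:
  assumes "acts_freely D G \<Gamma>" "\<gamma> \<in> \<Gamma>" "v \<in> verts G" "fst \<gamma> v = v"
  shows "\<gamma> = \<one>\<^bsub>Aut\<^esub>"
proof (rule ccontr)
  assume "\<gamma> \<noteq> \<one>\<^bsub>Aut\<^esub>"
  then have "\<not> same_point G (map_point (fst \<gamma>) (snd \<gamma>) (Vertex v)) (Vertex v)"
    using assms(1-3) unfolding acts_freely_def points_def by blast
  then show False using assms(4) by (simp add: same_point_def)
qed

text \<open>By freeness, an element of \<open>\<Gamma>\<close> is determined by its value at one
  vertex. Both \<open>s (fst \<gamma> v)\<close> times \<open>\<gamma>\<close> and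
  \<open>s v\<close> move \<open>v\<close> to the representative of its orbit.\<close>

lemma acts_freely_section:
  assumes \<Gamma>: "subgroup \<Gamma> Aut" and free: "acts_freely D G \<Gamma>"
  shows "\<exists>s. \<forall>v\<in>verts G. s v \<in> \<Gamma> \<and> (\<forall>\<gamma>\<in>\<Gamma>. s (fst \<gamma> v) \<otimes>\<^bsub>Aut\<^esub> \<gamma> = s v)"
proof -
  interpret \<Gamma>: subgroup \<Gamma> Aut by fact
  define orbit_of where "orbit_of v = (\<lambda>\<gamma>. fst \<gamma> v) ` \<Gamma>" for v
  \<comment> \<open>The representative is chosen from the orbit as a set, hence is the same for
    \<open>v\<close> and \<open>fst \<gamma> v\<close>.\<close>
  define rep where "rep v = (SOME u. u \<in> orbit_of v)" for v
  define s where "s v = (SOME \<gamma>. \<gamma> \<in> \<Gamma> \<and> fst \<gamma> v = rep v)" for v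
  have s: "s v \<in> \<Gamma> \<and> fst (s v) v = rep v" for v
  proof -
    \<comment> \<open>Here \<open>v\<close> is arbitrary, possibly not a vertex, so the value of the
      identity at \<open>v\<close> serves as the element of \<open>orbit_of v\<close>.\<close>
    have "fst \<one>\<^bsub>Aut\<^esub> v \<in> orbit_of v" unfolding orbit_of_def using \<Gamma>.one_closed by (rule imageI)
    then have "rep v \<in> orbit_of v" unfolding rep_def by (rule someI)
    then obtain \<gamma> where "rep v = fst \<gamma> v" "\<gamma> \<in> \<Gamma>" unfolding orbit_of_def by (rule imageE)
    then have "\<exists>\<gamma>. \<gamma> \<in> \<Gamma> \<and> fst \<gamma> v = rep v" by metis
    from someI_ex[OF this] show ?thesis unfolding s_def .
  qed
  have "s (fst \<gamma> v) \<otimes>\<^bsub>Aut\<^esub> \<gamma> = s v" if v: "v \<in> verts G" and \<gamma>: "\<gamma> \<in> \<Gamma>" for v \<gamma>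
  proof -
    note c = \<Gamma>.mem_carrier
    have "orbit_of (fst \<gamma> v) = orbit_of v"
      unfolding orbit_of_def
    proof (intro equalityI image_subsetI)
      fix \<delta> assume \<delta>: "\<delta> \<in> \<Gamma>"
      show "fst \<delta> (fst \<gamma> v) \<in> (\<lambda>\<gamma>. fst \<gamma> v) ` \<Gamma>"
        using Aut_mult(1)[OF v, of \<delta> \<gamma>] \<Gamma>.m_closed[OF \<delta> \<gamma>] by (metis imageI)
      have "fst \<delta> v = fst (\<delta> \<otimes>\<^bsub>Aut\<^esub> inv\<^bsub>Aut\<^esub> \<gamma>) (fst \<gamma> v)"
        using v \<gamma> by (simp add: Aut_mult Aut_maps Aut_inv c)
      then show "fst \<delta> v \<in> (\<lambda>\<delta>. fst \<delta> (fst \<gamma> v)) ` \<Gamma>"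
        using \<Gamma>.m_closed[OF \<delta> \<Gamma>.m_inv_closed[OF \<gamma>]] by simp
    qed
    then have "fst (s (fst \<gamma> v)) (fst \<gamma> v) = fst (s v) v"
      using s by (simp add: rep_def)
    then have "fst (inv\<^bsub>Aut\<^esub> (s v) \<otimes>\<^bsub>Aut\<^esub> (s (fst \<gamma> v) \<otimes>\<^bsub>Aut\<^esub> \<gamma>)) v = v"
      using Aut_inv(1)[OF c[of "s v"] v] s[of v] v by (simp add: Aut_mult)
    moreover have "inv\<^bsub>Aut\<^esub> (s v) \<otimes>\<^bsub>Aut\<^esub> (s (fst \<gamma> v) \<otimes>\<^bsub>Aut\<^esub> \<gamma>) \<in> \<Gamma>"
      using s \<gamma> by simp
    ultimately have "inv\<^bsub>Aut\<^esub> (s v) \<otimes>\<^bsub>Aut\<^esub> (s (fst \<gamma> v) \<otimes>\<^bsub>Aut\<^esub> \<gamma>) = \<one>\<^bsub>Aut\<^esub>"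
      using acts_freely_fixed_vertex[OF free] v by blast
    moreover have "s v \<in> carrier Aut" "s (fst \<gamma> v) \<otimes>\<^bsub>Aut\<^esub> \<gamma> \<in> carrier Aut"
      using s \<gamma> c by simp_all
    ultimately show ?thesis by (metis inv_closed inv_equality inv_inv)
  qed
  then show ?thesis using s by blast
qed

text \<open>The label \<open>t e\<close> measures how \<open>s\<close> changes across
  \<open>e\<close>. Applying \<open>\<gamma>\<close> to \<open>e\<close> leaves unchanged the two
  edges that \<open>t e\<close> has to match, so a choice that depends on these edges alone is
  invariant.\<close>

lemma invariant_transition_labels:
  assumes C: "is_graph C" "no_loops C"
    and H: "subgroup H Aut" "coloring_induces_iso C D G H"
    and \<Gamma>: "subgroup \<Gamma> Aut"
    and s: "\<And>v. v \<in> verts G \<Longrightarrow> s v \<in> \<Gamma>"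
    and s_inv: "\<And>v \<gamma>. v \<in> verts G \<Longrightarrow> \<gamma> \<in> \<Gamma> \<Longrightarrow> s (fst \<gamma> v) \<otimes>\<^bsub>Aut\<^esub> \<gamma> = s v"
  shows "\<exists>t. \<forall>e\<in>arcs G. t e \<in> H \<and> snd (t e) (snd (s (head G e)) e) = snd (s (tail G e)) e \<and>
    t (ebar G e) = inv\<^bsub>Aut\<^esub> (t e) \<and> (\<forall>\<gamma>\<in>\<Gamma>. t (snd \<gamma> e) = t e)"
proof -
  interpret H: subgroup H Aut by fact
  interpret \<Gamma>: subgroup \<Gamma> Aut by fact
  have ecol: "ecol G e \<in> arcs C" "ecol G (ebar G e) = ebar C (ecol G e)" if "e \<in> arcs G" for e
    using sr that unfolding is_sr_graph_def graph_hom_def by auto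
  \<comment> \<open>The orientation is taken on the colors and not on the edges of \<open>G\<close>:
    \<open>\<Gamma>\<close> preserves colors, so the case distinction in \<open>t\<close> is
    \<open>\<Gamma>\<close>-invariant.\<close>
  obtain P where P: "\<And>k. k \<in> arcs C \<Longrightarrow> ebar C k \<in> P \<longleftrightarrow> k \<notin> P"
    using no_loops_orientation[OF C] by blast
  define \<tau> where "\<tau> x y = (SOME h. h \<in> H \<and> snd h y = x)" for x y
  define \<sigma> where "\<sigma> e = \<tau> (snd (s (tail G e)) e) (snd (s (head G e)) e)" for e
  \<comment> \<open>The independent choices for \<open>e\<close> and \<open>ebar G e\<close> need
    not be inverse to each other, so a choice is used only for colors in \<open>P\<close> and its
    inverse on the opposite edges.\<close>
  define t where "t e = (if ecol G e \<in> P then \<sigma> e else inv\<^bsub>Aut\<^esub> (\<sigma> (ebar G e)))" for e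
  have s_arc: "snd (s (tail G e)) e \<in> arcs G" "snd (s (head G e)) e \<in> arcs G"
    "ebar G (snd (s (tail G e)) e) = snd (s (tail G e)) (ebar G e)"
    "ebar G (snd (s (head G e)) e) = snd (s (head G e)) (ebar G e)"
    "ecol G (snd (s (tail G e)) e) = ecol G e" "ecol G (snd (s (head G e)) e) = ecol G e"
    if "e \<in> arcs G" for e
    using that arcD s \<Gamma>.mem_carrier by (auto simp: Aut_maps Aut_commutes)
  have \<sigma>: "\<sigma> e \<in> H \<and> snd (\<sigma> e) (snd (s (head G e)) e) = snd (s (tail G e)) e"
    if "e \<in> arcs G" for e
  proof -
    have "\<exists>h. h \<in> H \<and> snd h (snd (s (head G e)) e) = snd (s (tail G e)) e"
      using coloring_iso_transitive[OF H s_arc(2,1)[OF that]] s_arc(5,6)[OF that] by metis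
    from someI_ex[OF this] show ?thesis unfolding \<sigma>_def \<tau>_def .
  qed
  show ?thesis
  proof (intro exI[of _ t] ballI conjI)
    fix e assume e: "e \<in> arcs G"
    note bar = arcD[OF e]
    show "t e \<in> H" using \<sigma> e bar by (simp add: t_def)
    show "t (ebar G e) = inv\<^bsub>Aut\<^esub> (t e)"
      using P[OF ecol(1)[OF e]] ecol(2)[OF e] bar \<sigma> e H.mem_carrier by (auto simp: t_def)
    show "snd (t e) (snd (s (head G e)) e) = snd (s (tail G e)) e"
    proof (cases "ecol G e \<in> P")
      case True
      then show ?thesis using \<sigma> e by (simp add: t_def)
    next
      case False
      let ?h = "\<sigma> (ebar G e)"
      have h: "?h \<in> carrier Aut" and "snd ?h (snd (s (tail G e)) (ebar G e)) = snd (s (head G e)) (ebar G e)"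
        using \<sigma>[OF bar(3)] bar H.mem_carrier by auto
      \<comment> \<open>The defining property of \<open>?h\<close> concerns \<open>ebar G e\<close>,
        whose tail is the head of \<open>e\<close>. Commuting with the involution transfers it to
        \<open>e\<close>, with the roles of the two ends exchanged.\<close>
      then have "ebar G (snd ?h (snd (s (tail G e)) e)) = ebar G (snd (s (head G e)) e)"
        using s_arc[OF e] Aut_commutes(3)[OF h s_arc(1)[OF e]] by simp
      then have "snd ?h (snd (s (tail G e)) e) = snd (s (head G e)) e"
        using arcD(4)[OF Aut_maps(2)[OF h s_arc(1)[OF e]]] arcD(4)[OF s_arc(2)[OF e]] by metis
      then show ?thesis using False Aut_inv(2)[OF h s_arc(1)[OF e]] by (simp add: t_def)
    qed
    fix \<gamma> assume \<gamma>: "\<gamma> \<in> \<Gamma>"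
    have shift: "snd (s (fst \<gamma> v)) (snd \<gamma> f) = snd (s v) f" if "v \<in> verts G" "f \<in> arcs G" for v f
      using s_inv[OF that(1) \<gamma>] Aut_mult(2)[OF that(2), of "s (fst \<gamma> v)" \<gamma>] by simp
    have "\<sigma> (snd \<gamma> f) = \<sigma> f" if "f \<in> arcs G" for f
      using that arcD[OF that] \<gamma> \<Gamma>.mem_carrier by (simp add: \<sigma>_def Aut_commutes shift)
    then show "t (snd \<gamma> e) = t e"
      using e bar \<gamma> \<Gamma>.mem_carrier by (simp add: t_def Aut_commutes)
  qed
qed

end

section \<open>Conjugation of \<open>\<Gamma>\<close> into \<open>H\<close>\<close>

theorem theorem4p2:
  fixes C :: "('i, 'k) igraph"
    and D :: "('i, 'k, 'd, 'x) sr_data"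
    and T :: "('v, 'e, 'i, 'k, 'd) sr_graph"
    and H \<Gamma> :: "(('v \<Rightarrow> 'v) \<times> ('e \<Rightarrow> 'e)) set"
  assumes "is_graph C" and "no_loops C"
    and "is_sr_data C D"
    and "is_sr_graph C D T" and "is_tree T"
    and "subgroup H (sr_Aut D T)" and "coloring_induces_iso C D T H"
    and "subgroup \<Gamma> (sr_Aut D T)" and "acts_freely D T \<Gamma>"
  shows "\<exists>g\<in>carrier (sr_Aut D T).
           (\<lambda>\<gamma>. g \<otimes>\<^bsub>sr_Aut D T\<^esub> \<gamma> \<otimes>\<^bsub>sr_Aut D T\<^esub> inv\<^bsub>sr_Aut D T\<^esub> g) ` \<Gamma> \<subseteq> H"
proof -
  interpret symmetry_restricted_graph C D T by unfold_locales fact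
  interpret H: subgroup H Aut by fact
  interpret \<Gamma>: subgroup \<Gamma> Aut by fact
  obtain s where s: "\<And>v. v \<in> verts T \<Longrightarrow> s v \<in> \<Gamma>"
    and s_inv: "\<And>v \<gamma>. v \<in> verts T \<Longrightarrow> \<gamma> \<in> \<Gamma> \<Longrightarrow> s (fst \<gamma> v) \<otimes>\<^bsub>Aut\<^esub> \<gamma> = s v"
    using acts_freely_section[OF assms(8,9)] by blast
  obtain t where t: "\<And>e. e \<in> arcs T \<Longrightarrow> t e \<in> H"
    and t_arc: "\<And>e. e \<in> arcs T \<Longrightarrow> snd (t e) (snd (s (head T e)) e) = snd (s (tail T e)) e"
    and t_bar: "\<And>e. e \<in> arcs T \<Longrightarrow> t (ebar T e) = inv\<^bsub>Aut\<^esub> (t e)"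
    and t_inv: "\<And>e \<gamma>. e \<in> arcs T \<Longrightarrow> \<gamma> \<in> \<Gamma> \<Longrightarrow> t (snd \<gamma> e) = t e"
    using invariant_transition_labels[OF assms(1,2,6,7,8) s s_inv] by blast
  obtain v0 where v0: "v0 \<in> verts T" using graph_verts_nonempty[OF graph] by blast
  obtain h where h0: "h v0 = \<one>\<^bsub>Aut\<^esub>"
    and h_step: "\<And>e. e \<in> arcs T \<Longrightarrow> h (head T e) = h (tail T e) \<otimes>\<^bsub>Aut\<^esub> t e"
    using tree_potential[OF is_group assms(5) v0, of t] t t_bar H.mem_carrier by blast
  \<comment> \<open>The potential was formed in the whole group \<open>Aut\<close>; membership in
    \<open>H\<close> spreads from \<open>v0\<close>, each step multiplying by a label in
    \<open>H\<close>.\<close>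
  have h: "h v \<in> H" if "v \<in> verts T" for v
    by (rule graph_induct[OF graph v0 that]) (auto simp: h0 h_step t)
  \<comment> \<open>As functions of \<open>v\<close> both sides are multiplied by \<open>t e\<close>
    on the right across \<open>e\<close>, by invariance of \<open>t\<close>, and they agree at
    \<open>v0\<close> because \<open>h v0\<close> is the identity.\<close>
  have h_shift: "h (fst \<gamma> v) = h (fst \<gamma> v0) \<otimes>\<^bsub>Aut\<^esub> h v" if \<gamma>: "\<gamma> \<in> \<Gamma>" and v: "v \<in> verts T" for \<gamma> v
  proof (rule graph_induct[OF graph v0 v])
    have maps: "fst \<gamma> v \<in> verts T" if "v \<in> verts T" for v
      using \<gamma> that Aut_maps(1) \<Gamma>.mem_carrier by blast
    then show "h (fst \<gamma> v0) = h (fst \<gamma> v0) \<otimes>\<^bsub>Aut\<^esub> h v0"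
      using h v0 H.mem_carrier by (simp add: h0)
    fix e assume e: "e \<in> arcs T" and IH: "h (fst \<gamma> (tail T e)) = h (fst \<gamma> v0) \<otimes>\<^bsub>Aut\<^esub> h (tail T e)"
    have "h (fst \<gamma> (head T e)) = h (fst \<gamma> (tail T e)) \<otimes>\<^bsub>Aut\<^esub> t e"
      using h_step[of "snd \<gamma> e"] t_inv[OF e \<gamma>] Aut_maps(2) Aut_commutes(1,2) \<Gamma>.mem_carrier[OF \<gamma>] e
      by simp
    then show "h (fst \<gamma> (head T e)) = h (fst \<gamma> v0) \<otimes>\<^bsub>Aut\<^esub> h (head T e)"
      using IH h_step[OF e] h maps v0 t[OF e] arcD[OF e] H.mem_carrier by (simp add: m_assoc)
  qed
  have hs: "h v \<otimes>\<^bsub>Aut\<^esub> s v \<in> carrier Aut" if "v \<in> verts T" for v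
    using h s that H.mem_carrier \<Gamma>.mem_carrier by blast
  \<comment> \<open>Crossing \<open>e\<close> multiplies \<open>h\<close> by \<open>t e\<close>,
    which takes the image of \<open>e\<close> under \<open>s\<close> at the head to that at the
    tail; this is the compatibility needed for gluing.\<close>
  have "snd (h (head T e) \<otimes>\<^bsub>Aut\<^esub> s (head T e)) e = snd (h (tail T e) \<otimes>\<^bsub>Aut\<^esub> s (tail T e)) e"
    if e: "e \<in> arcs T" for e
    using e arcD[OF e] s \<Gamma>.mem_carrier t_arc[OF e] by (simp add: Aut_mult Aut_maps h_step)
  then obtain g where g: "g \<in> carrier Aut"
    and gV: "\<And>v. v \<in> verts T \<Longrightarrow> fst g v = fst (h v \<otimes>\<^bsub>Aut\<^esub> s v) v"
    and gE: "\<And>e. e \<in> arcs T \<Longrightarrow> snd g e = snd (h (tail T e) \<otimes>\<^bsub>Aut\<^esub> s (tail T e)) e"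
    using Aut_glue[OF assms(5), of "\<lambda>v. h v \<otimes>\<^bsub>Aut\<^esub> s v"] hs by blast
  have "g \<otimes>\<^bsub>Aut\<^esub> \<gamma> \<otimes>\<^bsub>Aut\<^esub> inv\<^bsub>Aut\<^esub> g \<in> H" if \<gamma>: "\<gamma> \<in> \<Gamma>" for \<gamma>
  proof -
    let ?\<rho> = "h (fst \<gamma> v0)"
    note c = \<Gamma>.mem_carrier[OF \<gamma>]
    have \<rho>: "?\<rho> \<in> H" using h Aut_maps(1)[OF c v0] .
    \<comment> \<open>The factor \<open>?\<rho>\<close> depends on \<open>\<gamma>\<close> but not
      on \<open>v\<close>, so the local identities combine into one equation between
      automorphisms.\<close>
    have pointwise: "h (fst \<gamma> v) \<otimes>\<^bsub>Aut\<^esub> s (fst \<gamma> v) \<otimes>\<^bsub>Aut\<^esub> \<gamma> = ?\<rho> \<otimes>\<^bsub>Aut\<^esub> (h v \<otimes>\<^bsub>Aut\<^esub> s v)"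
      if v: "v \<in> verts T" for v
    proof -
      have "h v \<in> carrier Aut" "s v \<in> carrier Aut" "s (fst \<gamma> v) \<in> carrier Aut"
        using h s v Aut_maps(1)[OF c v] H.mem_carrier \<Gamma>.mem_carrier by blast+
      then show ?thesis
        using h_shift[OF \<gamma> v] s_inv[OF v \<gamma>] c H.mem_carrier[OF \<rho>] by (simp add: m_assoc)
    qed
    \<comment> \<open>At \<open>v\<close> and its star, \<open>g\<close> after
      \<open>\<gamma>\<close> uses the piece of \<open>g\<close> belonging to
      \<open>fst \<gamma> v\<close>, which gives the left side of \<open>pointwise\<close>. The
      conjugate of \<open>\<gamma>\<close> by \<open>g\<close> is therefore
      \<open>?\<rho>\<close>.\<close>
    have "g \<otimes>\<^bsub>Aut\<^esub> \<gamma> = ?\<rho> \<otimes>\<^bsub>Aut\<^esub> g"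
    proof (rule Aut_eqI)
      show "fst (g \<otimes>\<^bsub>Aut\<^esub> \<gamma>) v = fst (?\<rho> \<otimes>\<^bsub>Aut\<^esub> g) v" if v: "v \<in> verts T" for v
        using pointwise[OF v] gV[OF v] gV[OF Aut_maps(1)[OF c v]] Aut_mult(1)[OF v] by metis
      show "snd (g \<otimes>\<^bsub>Aut\<^esub> \<gamma>) e = snd (?\<rho> \<otimes>\<^bsub>Aut\<^esub> g) e" if e: "e \<in> arcs T" for e
        using pointwise[OF arcD(1)[OF e]] gE[OF e] gE[OF Aut_maps(2)[OF c e]] Aut_mult(2)[OF e]
          Aut_commutes(1)[OF c e] by metis
    qed (use g c H.mem_carrier[OF \<rho>] in auto)
    then show ?thesis using \<rho> g c H.mem_carrier[OF \<rho>] by (simp add: m_assoc)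
  qed
  then show ?thesis using g by blast
qed

end
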